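(* Let $(\mathcal{T},\leq)$ be a rooted non-metric tree. If there is an element $\sigma\in\mathcal{T}$ with uncountably many branches (that is, the set of tangent vectors at $\sigma$ is uncountable), then the weak tree topology on $\mathcal{T}$ is not first countable. In particular, for any (increasing) parametrization $\Psi:\mathcal{T}\to[1,\infty]$, the weak tree topology is strictly coarser than the topology given by the metric $d_\Psi$.
   Context: A rooted non-metric tree is a poset $(\mathcal{T},\leq)$ such that: (T1) there exists a (unique) smallest element $\tau_0\in\mathcal{T}$; (T2) every set of the form $I_\tau=\{\sigma\in\mathcal{T}\mid\sigma\leq\tau\}$ is isomorphic, as an ordered set, to a real interval; (T3) every totally ordered convex subset of $\mathcal{T}$ is isomorphic to a real interval; (T4) every non-empty subset of $\mathcal{T}$ has an infimum in $\mathcal{T}$. The infimum of $\{\tau,\sigma\}$ is written $\tau\wedge\sigma$. For $\tau,\sigma\in\mathcal{T}$ the closed segment is $[\tau,\sigma]=\{\alpha\in\mathcal{T}\mid \tau\wedge\sigma\leq\alpha\leq\tau \text{ or } \tau\wedge\sigma\leq\alpha\leq\sigma\}$, and $]\tau,\sigma]=[\tau,\sigma]\setminus\{\tau\}$. For $\tau\in\mathcal{T}$, define an equivalence relation on $\mathcal{T}\setminus\{\tau\}$ by $\sigma\sim_\tau\alpha$ if and only if $]\tau,\sigma]\cap]\tau,\alpha]\neq\emptyset$. The equivalence class of $\sigma$ is denoted $[\sigma]_\tau\subseteq\mathcal{T}\setminus\{\tau\}$ and is called a tangent vector at $\tau$, or a branch emanating from $\tau$. The set of all equivalence classes is the tangent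 space of $\mathcal{T}$ at $\tau$. The weak tree topology on $\mathcal{T}$ is the topology generated by all tangent vectors, i.e. its open sets are the unions of finite intersections of sets of the form $[\sigma]_\tau$ (with $\tau\in\mathcal{T}$, $\sigma\in\mathcal{T}\setminus\{\tau\}$). An (increasing) parametrization of $\mathcal{T}$ is an increasing map $\Psi:\mathcal{T}\to[-\infty,\infty]$ whose restriction to every totally ordered convex subset of $\mathcal{T}$ is an isomorphism of ordered sets onto a (possibly extended) real interval. For an increasing parametrization $\Psi:\mathcal{T}\to[1,\infty]$, the metric $d_\Psi$ is defined by $$d_\Psi(\tau,\sigma)=\left(\frac{1}{\Psi(\tau\wedge\sigma)}-\frac{1}{\Psi(\tau)}\right)+\left(\frac{1}{\Psi(\tau\wedge\sigma)}-\frac{1}{\Psi(\sigma)}\right),$$ with the convention $1/\infty=0$. *)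

theory Defs
  imports "HOL-Analysis.Analysis"
begin

text \<open>A poset is a set \<open>T\<close> of elements of an ordered type, with the induced order.\<close>

definition order_convex_in :: "'a::order set \<Rightarrow> 'a set \<Rightarrow> bool" where
  "order_convex_in T C \<longleftrightarrow>
     C \<subseteq> T \<and> (\<forall>x\<in>C. \<forall>y\<in>C. \<forall>z\<in>T. x \<le> z \<and> z \<le> y \<longrightarrow> z \<in> C)"

definition order_isomorphism_on :: "'a::order set \<Rightarrow> 'b::order set \<Rightarrow> ('a \<Rightarrow> 'b) \<Rightarrow> bool" where
  "order_isomorphism_on A B f \<longleftrightarrow>
     bij_betw f A B \<and> (\<forall>x\<in>A. \<forall>y\<in>A. x \<le> y \<longleftrightarrow> f x \<le> f y)"

definition totally_ordered :: "'a::order set \<Rightarrow> bool" where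
  "totally_ordered C \<longleftrightarrow> (\<forall>x\<in>C. \<forall>y\<in>C. x \<le> y \<or> y \<le> x)"

text \<open>The intervals of a linear order are its order-convex subsets. Empty and one-point intervals
  are included: the down-set of the root is a point.\<close>

definition isomorphic_to_real_interval :: "'a::order set \<Rightarrow> bool" where
  "isomorphic_to_real_interval A \<longleftrightarrow>
     (\<exists>(J :: real set) f. order_convex_in UNIV J \<and> order_isomorphism_on A J f)"

definition is_inf_in :: "'a::order set \<Rightarrow> 'a set \<Rightarrow> 'a \<Rightarrow> bool" where
  "is_inf_in T A m \<longleftrightarrow>
     m \<in> T \<and> (\<forall>a\<in>A. m \<le> a) \<and> (\<forall>b\<in>T. (\<forall>a\<in>A. b \<le> a) \<longrightarrow> b \<le> m)"

locale rooted_nonmetric_tree =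
  fixes T :: "'a::order set"
  assumes T1: "\<exists>\<tau>0\<in>T. \<forall>\<tau>\<in>T. \<tau>0 \<le> \<tau>"
    and T2: "\<tau> \<in> T \<Longrightarrow> isomorphic_to_real_interval {\<sigma>\<in>T. \<sigma> \<le> \<tau>}"
    and T3: "order_convex_in T C \<Longrightarrow> totally_ordered C \<Longrightarrow> isomorphic_to_real_interval C"
    and T4: "A \<subseteq> T \<Longrightarrow> A \<noteq> {} \<Longrightarrow> \<exists>m. is_inf_in T A m"

definition tree_meet :: "'a::order set \<Rightarrow> 'a \<Rightarrow> 'a \<Rightarrow> 'a" where
  "tree_meet T \<tau> \<sigma> = (THE m. is_inf_in T {\<tau>, \<sigma>} m)"

definition segment :: "'a::order set \<Rightarrow> 'a \<Rightarrow> 'a \<Rightarrow> 'a set" where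
  "segment T \<tau> \<sigma> =
     {\<alpha>\<in>T. (tree_meet T \<tau> \<sigma> \<le> \<alpha> \<and> \<alpha> \<le> \<tau>) \<or> (tree_meet T \<tau> \<sigma> \<le> \<alpha> \<and> \<alpha> \<le> \<sigma>)}"

definition left_open_segment :: "'a::order set \<Rightarrow> 'a \<Rightarrow> 'a \<Rightarrow> 'a set" where
  "left_open_segment T \<tau> \<sigma> = segment T \<tau> \<sigma> - {\<tau>}"

definition branch_rel :: "'a::order set \<Rightarrow> 'a \<Rightarrow> ('a \<times> 'a) set" where
  "branch_rel T \<tau> =
     {(\<sigma>, \<alpha>). \<sigma> \<in> T - {\<tau>} \<and> \<alpha> \<in> T - {\<tau>} \<and>
        left_open_segment T \<tau> \<sigma> \<inter> left_open_segment T \<tau> \<alpha> \<noteq> {}}"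

definition tangent_space :: "'a::order set \<Rightarrow> 'a \<Rightarrow> 'a set set" where
  "tangent_space T \<tau> = (T - {\<tau>}) // branch_rel T \<tau>"

text \<open>The subbase is taken relative to \<open>T\<close>, so the empty intersection is \<open>T\<close> and the underlying
  space is \<open>T\<close> even for the one-point tree, which has no tangent vectors.\<close>

definition weak_tree_topology :: "'a::order set \<Rightarrow> 'a topology" where
  "weak_tree_topology T =
     topology (arbitrary union_of
       (finite intersection_of (\<lambda>U. U \<in> (\<Union>\<tau>\<in>T. tangent_space T \<tau>)) relative_to T))"

definition increasing_parametrization :: "'a::order set \<Rightarrow> ('a \<Rightarrow> ereal) \<Rightarrow> bool" where
  "increasing_parametrization T \<Psi> \<longleftrightarrow>
     mono_on T \<Psi> \<and>
     (\<forall>C. order_convex_in T C \<and> totally_ordered C \<longrightarrow>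
        order_convex_in UNIV (\<Psi> ` C) \<and> order_isomorphism_on C (\<Psi> ` C) \<Psi>)"

text \<open>Division in \<^typ>\<open>ereal\<close> satisfies \<open>1 / \<infinity> = 0\<close>; for values of \<open>\<Psi>\<close> in \<open>{1..\<infinity>}\<close> all
  reciprocals are finite, so passing to \<^typ>\<open>real\<close> loses nothing. The value \<open>0\<close> outside
  \<open>T\<close> is only there because the locale \<^locale>\<open>Metric_space\<close> requires nonnegativity
  on the whole type.\<close>

definition tree_dist :: "'a::order set \<Rightarrow> ('a \<Rightarrow> ereal) \<Rightarrow> 'a \<Rightarrow> 'a \<Rightarrow> real" where
  "tree_dist T \<Psi> \<tau> \<sigma> =
     (if \<tau> \<in> T \<and> \<sigma> \<in> T then
        (real_of_ereal (1 / \<Psi> (tree_meet T \<tau> \<sigma>)) - real_of_ereal (1 / \<Psi> \<tau>)) +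
        (real_of_ereal (1 / \<Psi> (tree_meet T \<tau> \<sigma>)) - real_of_ereal (1 / \<Psi> \<sigma>))
      else 0)"

context rooted_nonmetric_tree
begin

lemma is_inf_tree_meet:
  assumes "\<tau> \<in> T" "\<sigma> \<in> T"
  shows "is_inf_in T {\<tau>, \<sigma>} (tree_meet T \<tau> \<sigma>)"
proof -
  obtain m where m: "is_inf_in T {\<tau>, \<sigma>} m"
    using T4[of "{\<tau>, \<sigma>}"] assms by auto
  have "m' = m" if "is_inf_in T {\<tau>, \<sigma>} m'" for m'
    using m that unfolding is_inf_in_def by (meson order.antisym)
  with m show ?thesis
    unfolding tree_meet_def by (rule theI)
qed

lemma tree_meet_props:
  assumes "\<tau> \<in> T" "\<sigma> \<in> T"
  shows "tree_meet T \<tau> \<sigma> \<in> T" "tree_meet T \<tau> \<sigma> \<le> \<tau>" "tree_meet T \<tau> \<sigma> \<le> \<sigma>"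
    and "\<And>b. b \<in> T \<Longrightarrow> b \<le> \<tau> \<Longrightarrow> b \<le> \<sigma> \<Longrightarrow> b \<le> tree_meet T \<tau> \<sigma>"
  using is_inf_tree_meet[OF assms] unfolding is_inf_in_def by auto

lemma tree_meet_commute: "tree_meet T \<tau> \<sigma> = tree_meet T \<sigma> \<tau>"
  by (simp add: tree_meet_def insert_commute)

lemma below_comparable:
  assumes "x \<in> T" "y \<in> T" "z \<in> T" "x \<le> z" "y \<le> z"
  shows "x \<le> y \<or> y \<le> x"
proof -
  obtain J :: "real set" and f where "order_isomorphism_on {\<sigma>\<in>T. \<sigma> \<le> z} J f"
    using T2[OF \<open>z \<in> T\<close>] unfolding isomorphic_to_real_interval_def by blast
  with assms show ?thesis
    unfolding order_isomorphism_on_def by (metis (mono_tags, lifting) linorder_linear mem_Collect_eq)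
qed

lemma parametrization_strict:
  assumes "increasing_parametrization T \<Psi>" "x \<in> T" "y \<in> T" "x < y"
  shows "\<Psi> x < \<Psi> y"
proof -
  let ?C = "{z\<in>T. x \<le> z \<and> z \<le> y}"
  have "order_convex_in T ?C"
    unfolding order_convex_in_def by auto
  moreover have "totally_ordered ?C"
    unfolding totally_ordered_def using below_comparable assms by auto
  ultimately have "order_isomorphism_on ?C (\<Psi> ` ?C) \<Psi>"
    using assms(1) unfolding increasing_parametrization_def by blast
  moreover have "x \<in> ?C" "y \<in> ?C"
    using assms by auto
  ultimately have "y \<le> x \<longleftrightarrow> \<Psi> y \<le> \<Psi> x"
    unfolding order_isomorphism_on_def by blast
  with \<open>x < y\<close> show ?thesis by auto
qed

lemma Metric_space_tree_dist:
  assumes par: "increasing_parametrization T \<Psi>" and range: "\<Psi> ` T \<subseteq> {1..\<infinity>}"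
  shows "Metric_space T (tree_dist T \<Psi>)"
proof -
  define f where "f x = real_of_ereal (1 / \<Psi> x)" for x
  have strict: "f y < f x" if "x \<in> T" "y \<in> T" "x < y" for x y
  proof -
    have "\<Psi> x < \<Psi> y" "1 \<le> \<Psi> x" "1 \<le> \<Psi> y"
      using parametrization_strict[OF par that] range that by auto
    then show ?thesis
      unfolding f_def
      by (cases "\<Psi> x"; cases "\<Psi> y") (auto simp: one_ereal_def frac_less2)
  qed
  have anti: "f y \<le> f x" if "x \<in> T" "y \<in> T" "x \<le> y" for x y
    using strict[of x y] that by (auto simp: order.order_iff_strict)
  have dist: "tree_dist T \<Psi> x y = 2 * f (tree_meet T x y) - f x - f y" if "x \<in> T" "y \<in> T" for x y
    using that by (simp add: tree_dist_def f_def)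
  show ?thesis
  proof
    fix x y
    show "0 \<le> tree_dist T \<Psi> x y"
    proof (cases "x \<in> T \<and> y \<in> T")
      case True
      then show ?thesis
        using anti[of "tree_meet T x y" x] anti[of "tree_meet T x y" y]
        by (simp add: dist tree_meet_props)
    qed (auto simp: tree_dist_def)
    show "tree_dist T \<Psi> x y = tree_dist T \<Psi> y x"
      by (simp add: tree_dist_def tree_meet_commute[of x y])
  next
    fix x y assume xy: "x \<in> T" "y \<in> T"
    show "tree_dist T \<Psi> x y = 0 \<longleftrightarrow> x = y"
    proof
      assume "x = y"
      with xy have "tree_meet T x y = x"
        using tree_meet_props[of x x] by (auto intro: order.antisym)
      with \<open>x = y\<close> xy show "tree_dist T \<Psi> x y = 0"
        by (simp add: dist)
    next
      assume 0: "tree_dist T \<Psi> x y = 0"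
      let ?m = "tree_meet T x y"
      note m = tree_meet_props[OF xy]
      have "f x \<le> f ?m" "f y \<le> f ?m"
        using anti m xy by auto
      with 0 have "f x = f ?m" "f y = f ?m"
        by (auto simp: dist xy)
      then have "?m = x" "?m = y"
        using strict[of ?m x] strict[of ?m y] m xy by (auto simp: order.order_iff_strict)
      then show "x = y" by simp
    qed
  next
    fix x y z assume xyz: "x \<in> T" "y \<in> T" "z \<in> T"
    let ?a = "tree_meet T x y" and ?b = "tree_meet T y z" and ?c = "tree_meet T x z"
    note a = tree_meet_props[OF xyz(1,2)] and b = tree_meet_props[OF xyz(2,3)]
      and c = tree_meet_props[OF xyz(1,3)]
    have "f ?c + f y \<le> f ?a + f ?b"
    proof (cases "?a \<le> ?b")
      case True
      then have "?a \<le> ?c"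
        using a b c(4) by (meson order.trans)
      then have "f ?c \<le> f ?a" "f y \<le> f ?b"
        using anti a b c xyz by auto
      then show ?thesis by simp
    next
      case False
      then have "?b \<le> ?a"
        using below_comparable[OF a(1) b(1) xyz(2)] a b by blast
      then have "?b \<le> ?c"
        using a b c(4) by (meson order.trans)
      then have "f ?c \<le> f ?b" "f y \<le> f ?a"
        using anti a b c xyz by auto
      then show ?thesis by simp
    qed
    then show "tree_dist T \<Psi> x z \<le> tree_dist T \<Psi> x y + tree_dist T \<Psi> y z"
      by (simp add: dist xyz)
  qed
qed

end

end

theory Submission
  imports Defs
begin

text \<open>
  Everything rests on one reformulation: two points other than \<open>\<tau>\<close> lie in the same branch at \<open>\<tau>\<close>
  iff \<open>\<tau>\<close> does not lie on the segment joining them (lemma \<open>branch_rel_iff\<close>). Branches are thus the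
  pieces into which the tree falls apart when \<open>\<tau>\<close> is removed.

  Suppose that \<open>\<sigma>\<close> lies in a branch \<open>B\<close> at some \<open>\<tau>\<close>. A point \<open>\<beta> \<noteq> \<sigma>\<close> outside \<open>B\<close> can be reached
  from \<open>\<sigma>\<close> only through \<open>\<tau>\<close>, so it lies in the branch at \<open>\<sigma>\<close> that contains \<open>\<tau>\<close>. Hence \<open>B\<close> contains
  every other branch at \<open>\<sigma>\<close>, and a weak neighbourhood of \<open>\<sigma>\<close>, which contains a finite intersection of
  such sets, contains all but finitely many branches at \<open>\<sigma>\<close> (lemma \<open>weak_open_contains_almost_all_branches\<close>).
  If there are uncountably many branches at \<open>\<sigma>\<close>, then for any countable family of neighbourhoods one
  branch \<open>v\<close> lies in all of them. But for \<open>\<tau> \<in> v\<close> the branch at \<open>\<tau>\<close> containing \<open>\<sigma>\<close> is a neighbourhood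
  of \<open>\<sigma>\<close> that omits \<open>\<tau>\<close>, so it contains no member of the family: there is no countable local base.

  For the comparison with \<open>d\<^sub>\<Psi>\<close>, the distance is additive along segments. So a point that is separated
  from \<open>\<alpha>\<close> by \<open>\<tau>\<close> is at least as far from \<open>\<alpha>\<close> as \<open>\<tau>\<close> is, and the ball of radius \<open>d\<^sub>\<Psi> \<alpha> \<tau>\<close> about
  \<open>\<alpha>\<close> stays in the branch of \<open>\<alpha>\<close> at \<open>\<tau>\<close>. All branches are therefore open in the metric topology, and
  the inclusion of topologies is strict since a metric topology is first countable, while the weak
  tree topology is not.
\<close>

context rooted_nonmetric_tree
begin

section \<open>Branches and separation by a point\<close>

lemma mem_segment_iff:
  assumes "\<tau> \<in> T"
  shows "\<tau> \<in> segment T \<alpha> \<beta> \<longleftrightarrow> tree_meet T \<alpha> \<beta> \<le> \<tau> \<and> (\<tau> \<le> \<alpha> \<or> \<tau> \<le> \<beta>)"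
  using assms unfolding segment_def by auto

lemma segment_commute: "segment T \<alpha> \<beta> = segment T \<beta> \<alpha>"
  unfolding segment_def tree_meet_commute[of \<alpha> \<beta>] by auto

lemma segment_refl:
  assumes "\<alpha> \<in> T"
  shows "segment T \<alpha> \<alpha> = {\<alpha>}"
proof -
  have "tree_meet T \<alpha> \<alpha> = \<alpha>"
    using tree_meet_props[OF assms assms] assms by (simp add: order.antisym)
  then show ?thesis
    using assms unfolding segment_def by auto
qed

lemma left_end_in_segment:
  assumes "\<alpha> \<in> T" "\<beta> \<in> T"
  shows "\<alpha> \<in> segment T \<alpha> \<beta>"
  using assms tree_meet_props[OF assms] by (simp add: mem_segment_iff)

text \<open>Points below a common bound are comparable, so of the meets of \<open>\<gamma>\<close> with the two ends of a
  segment, one is below the other; this forces the path from \<open>\<alpha>\<close> over \<open>\<gamma>\<close> to \<open>\<beta>\<close> to pass through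
  all of \<open>[\<alpha>, \<beta>]\<close>.\<close>

lemma segment_subset_Un:
  assumes T: "\<alpha> \<in> T" "\<beta> \<in> T" "\<gamma> \<in> T" "\<tau> \<in> T" and "\<tau> \<in> segment T \<alpha> \<beta>"
  shows "\<tau> \<in> segment T \<alpha> \<gamma> \<or> \<tau> \<in> segment T \<gamma> \<beta>"
proof -
  have below: "\<tau> \<in> segment T a \<gamma> \<or> \<tau> \<in> segment T \<gamma> b"
    if ab: "a \<in> T" "b \<in> T" and le: "\<tau> \<le> a" "tree_meet T a b \<le> \<tau>" for a b
  proof (cases "tree_meet T a \<gamma> \<le> \<tau>")
    case True
    with le T show ?thesis by (simp add: mem_segment_iff)
  next
    case False
    note ac = tree_meet_props[OF ab(1) T(3)] and cb = tree_meet_props[OF T(3) ab(2)]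
      and m = tree_meet_props[OF ab]
    have "\<tau> \<le> tree_meet T a \<gamma>"
      using False below_comparable[OF T(4) ac(1) ab(1)] le ac by blast
    then have "\<tau> \<le> \<gamma>"
      using ac(3) by (rule order.trans)
    moreover have "\<not> tree_meet T a \<gamma> \<le> tree_meet T \<gamma> b"
    proof
      assume "tree_meet T a \<gamma> \<le> tree_meet T \<gamma> b"
      then have "tree_meet T a \<gamma> \<le> tree_meet T a b"
        using m(4) ac(1,2) cb(3) by (meson order.trans)
      with le(2) False show False by (meson order.trans)
    qed
    then have "tree_meet T \<gamma> b \<le> tree_meet T a \<gamma>"
      using below_comparable[OF ac(1) cb(1) T(3)] ac cb by blast
    then have "tree_meet T \<gamma> b \<le> tree_meet T a b"
      using m(4) ac(2) cb(1,3) by (meson order.trans)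
    then have "tree_meet T \<gamma> b \<le> \<tau>"
      using le(2) by (rule order.trans)
    ultimately show ?thesis
      using T by (simp add: mem_segment_iff)
  qed
  from assms(5) consider "\<tau> \<le> \<alpha>" "tree_meet T \<alpha> \<beta> \<le> \<tau>" | "\<tau> \<le> \<beta>" "tree_meet T \<alpha> \<beta> \<le> \<tau>"
    using T by (auto simp: mem_segment_iff)
  then show ?thesis
  proof cases
    case 1
    then show ?thesis using below T by blast
  next
    case 2
    then show ?thesis
      using below[of \<beta> \<alpha>] T tree_meet_commute[of \<alpha> \<beta>] segment_commute by metis
  qed
qed

text \<open>If neither point is above \<open>\<tau>\<close>, both segments start downwards from \<open>\<tau>\<close>, and the larger of the
  two meets with \<open>\<tau>\<close> is common to them. If both points are above \<open>\<tau>\<close>, their meet is common unless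
  it is \<open>\<tau>\<close>. In the mixed case the segments leave \<open>\<tau>\<close> in opposite directions.\<close>

lemma branch_rel_iff:
  assumes "\<alpha> \<in> T - {\<tau>}" "\<beta> \<in> T - {\<tau>}" "\<tau> \<in> T"
  shows "(\<alpha>, \<beta>) \<in> branch_rel T \<tau> \<longleftrightarrow> \<tau> \<notin> segment T \<alpha> \<beta>"
proof -
  have T: "\<alpha> \<in> T" "\<beta> \<in> T" "\<alpha> \<noteq> \<tau>" "\<beta> \<noteq> \<tau>" using assms by auto
  note a = tree_meet_props[OF assms(3) T(1)] and b = tree_meet_props[OF assms(3) T(2)]
    and m = tree_meet_props[OF T(1,2)]
  let ?I = "left_open_segment T \<tau> \<alpha> \<inter> left_open_segment T \<tau> \<beta>"
  have mem: "x \<in> left_open_segment T \<tau> c \<longleftrightarrow>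
      x \<noteq> \<tau> \<and> tree_meet T \<tau> c \<le> x \<and> (x \<le> \<tau> \<or> x \<le> c)" if "x \<in> T" for x c
    using that by (auto simp: left_open_segment_def mem_segment_iff)
  have inT: "x \<in> T" if "x \<in> ?I" for x
    using that by (auto simp: left_open_segment_def segment_def)
  have disjoint: False
    if x: "x \<in> left_open_segment T \<tau> c" "x \<in> left_open_segment T \<tau> d" and cd: "c \<in> T" "d \<in> T"
      and le: "\<tau> \<le> c" "tree_meet T c d \<le> \<tau>" for x c d
  proof -
    have "x \<in> T" using x(1) by (auto simp: left_open_segment_def segment_def)
    note x' = x[unfolded mem[OF this]]
    have "\<tau> \<le> tree_meet T \<tau> c"
      using tree_meet_props(4)[OF assms(3) cd(1) assms(3)] le by simp
    then have "\<tau> \<le> x" using x' by (meson order.trans)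
    then have "x \<le> c" "x \<le> d" using x' by (auto dest: order.antisym)
    then have "x \<le> tree_meet T c d"
      using tree_meet_props(4)[OF cd \<open>x \<in> T\<close>] by blast
    then have "x \<le> \<tau>" using le(2) by (rule order.trans)
    with \<open>\<tau> \<le> x\<close> x' show False by (auto dest: order.antisym)
  qed
  have "?I = {}" if "\<tau> \<in> segment T \<alpha> \<beta>"
  proof -
    from that consider "\<tau> \<le> \<alpha>" "tree_meet T \<alpha> \<beta> \<le> \<tau>" | "\<tau> \<le> \<beta>" "tree_meet T \<beta> \<alpha> \<le> \<tau>"
      using assms tree_meet_commute[of \<alpha> \<beta>] by (auto simp: mem_segment_iff)
    then show ?thesis
      using disjoint T by cases blast+
  qed
  moreover have "\<tau> \<in> segment T \<alpha> \<beta>" if empty: "?I = {}"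
  proof -
    have above: "\<tau> \<le> \<alpha> \<or> \<tau> \<le> \<beta>"
    proof (rule ccontr)
      assume none: "\<not> (\<tau> \<le> \<alpha> \<or> \<tau> \<le> \<beta>)"
      then have ne: "tree_meet T \<tau> \<alpha> \<noteq> \<tau>" "tree_meet T \<tau> \<beta> \<noteq> \<tau>"
        using a b by auto
      have "tree_meet T \<tau> \<alpha> \<le> tree_meet T \<tau> \<beta> \<or> tree_meet T \<tau> \<beta> \<le> tree_meet T \<tau> \<alpha>"
        using below_comparable[OF a(1) b(1) assms(3)] a b by blast
      then have "tree_meet T \<tau> \<beta> \<in> ?I \<or> tree_meet T \<tau> \<alpha> \<in> ?I"
        using ne a b by (auto simp: mem)
      with empty show False by blast
    qed
    have "tree_meet T \<alpha> \<beta> \<le> \<tau>"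
    proof (cases "\<tau> \<le> \<alpha> \<and> \<tau> \<le> \<beta>")
      case True
      then have "tree_meet T \<alpha> \<beta> \<in> ?I" if "tree_meet T \<alpha> \<beta> \<noteq> \<tau>"
        using that a b m assms(3) by (auto simp: mem intro: order.trans)
      with empty show ?thesis by fastforce
    next
      case False
      then have "\<not> \<tau> \<le> tree_meet T \<alpha> \<beta>"
        using m by (meson order.trans)
      with above show ?thesis
        using below_comparable[OF m(1) assms(3)] T m by blast
    qed
    with above show ?thesis
      using assms by (simp add: mem_segment_iff)
  qed
  ultimately show ?thesis
    using assms unfolding branch_rel_def by blast
qed

lemma equiv_branch_rel:
  assumes "\<tau> \<in> T"
  shows "equiv (T - {\<tau>}) (branch_rel T \<tau>)"
proof (rule equivI)
  show sub: "branch_rel T \<tau> \<subseteq> (T - {\<tau>}) \<times> (T - {\<tau>})"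
    unfolding branch_rel_def by auto
  show "refl_on (T - {\<tau>}) (branch_rel T \<tau>)"
    by (rule refl_onI) (use assms in \<open>auto simp: branch_rel_iff segment_refl\<close>)
  show "sym (branch_rel T \<tau>)"
    unfolding branch_rel_def by (rule symI) blast
  show "trans (branch_rel T \<tau>)"
  proof (rule transI)
    fix \<alpha> \<gamma> \<beta>
    assume r: "(\<alpha>, \<gamma>) \<in> branch_rel T \<tau>" "(\<gamma>, \<beta>) \<in> branch_rel T \<tau>"
    then have "\<alpha> \<in> T - {\<tau>}" "\<gamma> \<in> T - {\<tau>}" "\<beta> \<in> T - {\<tau>}" using sub by auto
    with r show "(\<alpha>, \<beta>) \<in> branch_rel T \<tau>"
      using segment_subset_Un[of \<alpha> \<beta> \<gamma> \<tau>] assms by (auto simp: branch_rel_iff)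
  qed
qed

lemma tangent_vector_subset:
  assumes "\<tau> \<in> T" "B \<in> tangent_space T \<tau>"
  shows "B \<subseteq> T - {\<tau>}"
  using assms equiv_branch_rel in_quotient_imp_subset unfolding tangent_space_def by blast

lemma mem_tangent_vector_iff:
  assumes "\<tau> \<in> T" "B \<in> tangent_space T \<tau>" "\<alpha> \<in> B"
  shows "\<beta> \<in> B \<longleftrightarrow> \<beta> \<in> T - {\<tau>} \<and> \<tau> \<notin> segment T \<alpha> \<beta>"
proof -
  note eq = equiv_branch_rel[OF assms(1)] and B = assms(2)[unfolded tangent_space_def]
  have \<alpha>: "\<alpha> \<in> T - {\<tau>}" using tangent_vector_subset assms by blast
  have "\<beta> \<in> B \<longleftrightarrow> (\<alpha>, \<beta>) \<in> branch_rel T \<tau>"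
    using quotient_eq_iff[OF eq B B assms(3)] in_quotient_imp_closed[OF eq B assms(3)]
      in_quotient_imp_in_rel[OF eq B] assms(3) by blast
  also have "\<dots> \<longleftrightarrow> \<beta> \<in> T - {\<tau>} \<and> \<tau> \<notin> segment T \<alpha> \<beta>"
    using branch_rel_iff[OF \<alpha> _ assms(1)] unfolding branch_rel_def by blast
  finally show ?thesis .
qed

section \<open>Neighbourhoods in the weak tree topology\<close>

lemma topspace_weak_tree_topology: "topspace (weak_tree_topology T) = T"
  unfolding weak_tree_topology_def by simp

lemma openin_weak_tangent_vector:
  assumes "\<tau> \<in> T" "B \<in> tangent_space T \<tau>"
  shows "openin (weak_tree_topology T) B"
proof -
  have "B \<subseteq> T" using tangent_vector_subset[OF assms] by blast
  moreover have "B \<in> (\<Union>\<tau>\<in>T. tangent_space T \<tau>)" using assms by blast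
  ultimately show ?thesis
    unfolding weak_tree_topology_def openin_subbase
    by (intro arbitrary_union_of_inc relative_to_subset_inc finite_intersection_of_inc)
qed

lemma weak_tree_topology_minimal:
  assumes "\<And>\<tau> B. \<tau> \<in> T \<Longrightarrow> B \<in> tangent_space T \<tau> \<Longrightarrow> openin X B"
    and "openin X T" and "openin (weak_tree_topology T) U"
  shows "openin X U"
  using assms(3) unfolding weak_tree_topology_def
  by (rule minimal_topology_subbase[rotated 2]) (use assms(1,2) in auto)

text \<open>A branch at \<open>\<sigma>\<close> that does not lie in \<open>B\<close> contains a point that can be reached from \<open>\<sigma>\<close>
  only through \<open>\<tau>\<close>, hence is the branch in the direction of \<open>\<tau>\<close>.\<close>

lemma at_most_one_branch_not_inside:
  assumes "\<tau> \<in> T" "B \<in> tangent_space T \<tau>" "\<sigma> \<in> B"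
  shows "{v \<in> tangent_space T \<sigma>. \<not> v \<subseteq> B} \<subseteq> {branch_rel T \<sigma> `` {\<tau>}}"
proof (rule subsetI)
  fix v assume "v \<in> {v \<in> tangent_space T \<sigma>. \<not> v \<subseteq> B}"
  then obtain \<beta> where v: "v \<in> tangent_space T \<sigma>" and \<beta>: "\<beta> \<in> v" "\<beta> \<notin> B" by blast
  have \<sigma>: "\<sigma> \<in> T" "\<sigma> \<noteq> \<tau>" using tangent_vector_subset[OF assms(1,2)] assms(3) by auto
  note v' = v[unfolded tangent_space_def]
  have \<beta>T: "\<beta> \<in> T - {\<sigma>}" using tangent_vector_subset[OF \<sigma>(1) v] \<beta> by blast
  have "\<tau> \<in> segment T \<sigma> \<beta>"
    using mem_tangent_vector_iff[OF assms, of \<beta>] \<beta>(2) \<beta>T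
      left_end_in_segment[of \<tau> \<sigma>] segment_commute[of \<sigma> \<tau>] assms(1) \<sigma>(1) by auto
  moreover have "\<tau> \<in> segment T \<sigma> \<tau>"
    using left_end_in_segment[of \<tau> \<sigma>] segment_commute[of \<sigma> \<tau>] assms(1) \<sigma>(1) by auto
  ultimately have rel: "(\<tau>, \<beta>) \<in> branch_rel T \<sigma>"
    using \<sigma> assms(1) \<beta>T unfolding branch_rel_def left_open_segment_def by auto
  have eq: "equiv (T - {\<sigma>}) (branch_rel T \<sigma>)" by (rule equiv_branch_rel[OF \<sigma>(1)])
  have "v = branch_rel T \<sigma> `` {\<beta>}"
    using v' \<beta>(1) eq by (metis Image_singleton_iff equiv_class_eq_iff quotientE)
  also have "\<dots> = branch_rel T \<sigma> `` {\<tau>}"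
    using equiv_class_eq[OF eq rel] by simp
  finally show "v \<in> {branch_rel T \<sigma> `` {\<tau>}}" by simp
qed

text \<open>For fixed \<open>\<sigma>\<close> the subsets of \<open>T\<close> with this property form a topology: an intersection of
  two of them omits part of a branch only if one of them does. By the previous lemma all branches
  are open in it.\<close>

lemma weak_open_contains_almost_all_branches:
  assumes "openin (weak_tree_topology T) U" "\<sigma> \<in> U"
  shows "finite {v \<in> tangent_space T \<sigma>. \<not> v \<subseteq> U}"
proof -
  define P where "P U \<longleftrightarrow> U \<subseteq> T \<and> (\<sigma> \<in> U \<longrightarrow> finite {v \<in> tangent_space T \<sigma>. \<not> v \<subseteq> U})" for U
  have \<sigma>: "\<sigma> \<in> T"
    using assms openin_subset topspace_weak_tree_topology by blast
  have "istopology P"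
    unfolding istopology_def
  proof (intro conjI allI impI)
    fix U V assume P: "P U" "P V"
    have "finite {v \<in> tangent_space T \<sigma>. \<not> v \<subseteq> U \<inter> V}" if "\<sigma> \<in> U" "\<sigma> \<in> V"
      by (rule finite_subset[of _ "{v \<in> tangent_space T \<sigma>. \<not> v \<subseteq> U} \<union>
          {v \<in> tangent_space T \<sigma>. \<not> v \<subseteq> V}"])
        (use that P P_def in auto)
    with P show "P (U \<inter> V)" unfolding P_def by blast
  next
    fix \<U> assume \<U>: "\<forall>U\<in>\<U>. P U"
    have "finite {v \<in> tangent_space T \<sigma>. \<not> v \<subseteq> \<Union>\<U>}" if "U \<in> \<U>" "\<sigma> \<in> U" for U
      by (rule finite_subset[of _ "{v \<in> tangent_space T \<sigma>. \<not> v \<subseteq> U}"])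
        (use that \<U> P_def in auto)
    with \<U> show "P (\<Union>\<U>)" unfolding P_def by blast
  qed
  then have openP: "openin (topology P) = P" by (rule topology_inverse')
  have "P B" if B: "\<tau> \<in> T" "B \<in> tangent_space T \<tau>" for \<tau> B
    unfolding P_def using at_most_one_branch_not_inside[OF B] tangent_vector_subset[OF B]
    by (auto intro: finite_subset)
  moreover have "P T"
  proof -
    have "{v \<in> tangent_space T \<sigma>. \<not> v \<subseteq> T} = {}"
      using tangent_vector_subset[OF \<sigma>] by blast
    then show ?thesis unfolding P_def by (simp only: finite.emptyI) simp
  qed
  ultimately have "P U"
    using weak_tree_topology_minimal[of "topology P" U] assms(1) by (simp add: openP)
  with assms(2) show ?thesis by (simp add: P_def)
qed

text \<open>Only countably many branches at \<open>\<sigma>\<close> can fail to lie in all members of a countable local base,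
  but a branch that lies in all of them would lie in every neighbourhood of \<open>\<sigma>\<close>, against the
  separation of \<open>\<sigma>\<close> from each of its points.\<close>

lemma weak_tree_topology_not_first_countable:
  assumes "\<sigma> \<in> T" "uncountable (tangent_space T \<sigma>)"
  shows "\<not> first_countable (weak_tree_topology T)"
proof
  assume "first_countable (weak_tree_topology T)"
  then obtain \<B> where \<B>: "countable \<B>" "\<And>V. V \<in> \<B> \<Longrightarrow> openin (weak_tree_topology T) V"
    "\<And>U. openin (weak_tree_topology T) U \<Longrightarrow> \<sigma> \<in> U \<Longrightarrow> \<exists>V\<in>\<B>. \<sigma> \<in> V \<and> V \<subseteq> U"
    using assms(1) unfolding first_countable_def topspace_weak_tree_topology by meson
  define N where "N = {V \<in> \<B>. \<sigma> \<in> V}"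
  have "countable (\<Union>V\<in>N. {v \<in> tangent_space T \<sigma>. \<not> v \<subseteq> V})"
    using \<B>(1,2) weak_open_contains_almost_all_branches
    by (intro countable_UN) (auto simp: N_def intro: countable_finite)
  with assms(2) have "\<not> tangent_space T \<sigma> \<subseteq> (\<Union>V\<in>N. {v \<in> tangent_space T \<sigma>. \<not> v \<subseteq> V})"
    using countable_subset by blast
  then obtain v where v: "v \<in> tangent_space T \<sigma>" and inside: "\<And>V. V \<in> N \<Longrightarrow> v \<subseteq> V"
    by blast
  obtain \<tau> where \<tau>: "\<tau> \<in> v"
    using v in_quotient_imp_non_empty[OF equiv_branch_rel[OF assms(1)]]
    unfolding tangent_space_def by blast
  then have "\<tau> \<in> T" "\<sigma> \<in> T - {\<tau>}"
    using tangent_vector_subset[OF assms(1) v] assms(1) by auto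
  define B where "B = branch_rel T \<tau> `` {\<sigma>}"
  have B: "B \<in> tangent_space T \<tau>" "\<sigma> \<in> B"
    unfolding B_def tangent_space_def
    using \<open>\<sigma> \<in> T - {\<tau>}\<close> equiv_class_self[OF equiv_branch_rel[OF \<open>\<tau> \<in> T\<close>]]
    by (auto intro: quotientI)
  obtain V where "V \<in> N" "V \<subseteq> B"
    using \<B>(3)[OF openin_weak_tangent_vector[OF \<open>\<tau> \<in> T\<close> B(1)] B(2)] unfolding N_def by blast
  then have "\<tau> \<in> B" using inside \<tau> by blast
  then show False
    using tangent_vector_subset[OF \<open>\<tau> \<in> T\<close> B(1)] by blast
qed

section \<open>Comparison with the metric topology\<close>

text \<open>If \<open>\<tau>\<close> is on the \<open>\<alpha>\<close>-side of the segment, then \<open>\<alpha> \<and> \<tau> = \<tau>\<close> and \<open>\<tau> \<and> \<beta> = \<alpha> \<and> \<beta>\<close>, so the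
  terms at \<open>\<tau>\<close> cancel.\<close>

lemma tree_dist_additive_on_segment:
  assumes T: "\<alpha> \<in> T" "\<beta> \<in> T" "\<tau> \<in> T" and "\<tau> \<in> segment T \<alpha> \<beta>"
  shows "tree_dist T \<Psi> \<alpha> \<beta> = tree_dist T \<Psi> \<alpha> \<tau> + tree_dist T \<Psi> \<tau> \<beta>"
proof -
  have sym: "tree_dist T \<Psi> x y = tree_dist T \<Psi> y x" for x y
    by (simp add: tree_dist_def tree_meet_commute[of x y])
  have below: "tree_dist T \<Psi> a b = tree_dist T \<Psi> a \<tau> + tree_dist T \<Psi> \<tau> b"
    if ab: "a \<in> T" "b \<in> T" and le: "\<tau> \<le> a" "tree_meet T a b \<le> \<tau>" for a b
  proof -
    have "tree_meet T a \<tau> = \<tau>"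
      using tree_meet_props[OF ab(1) T(3)] le T(3) by (simp add: order.antisym)
    moreover have "tree_meet T \<tau> b = tree_meet T a b"
      using tree_meet_props[OF T(3) ab(2)] tree_meet_props[OF ab] le
      by (meson order.antisym order.trans)
    ultimately show ?thesis
      using ab T by (simp add: tree_dist_def)
  qed
  from assms(4) consider "\<tau> \<le> \<alpha>" "tree_meet T \<alpha> \<beta> \<le> \<tau>" | "\<tau> \<le> \<beta>" "tree_meet T \<beta> \<alpha> \<le> \<tau>"
    using T tree_meet_commute[of \<alpha> \<beta>] by (auto simp: mem_segment_iff)
  then show ?thesis
  proof cases
    case 1
    then show ?thesis using below T by blast
  next
    case 2
    then show ?thesis using below[of \<beta> \<alpha>] T by (simp add: sym)
  qed
qed

lemma openin_metric_tangent_vector: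
  assumes metric: "Metric_space T (tree_dist T \<Psi>)" and "\<tau> \<in> T" "B \<in> tangent_space T \<tau>"
  shows "openin (Metric_space.mtopology T (tree_dist T \<Psi>)) B"
proof -
  interpret Metric_space T "tree_dist T \<Psi>" by (rule metric)
  have sub: "B \<subseteq> T - {\<tau>}" using tangent_vector_subset assms by blast
  have "\<exists>r>0. mball \<alpha> r \<subseteq> B" if "\<alpha> \<in> B" for \<alpha>
  proof (intro exI conjI subsetI)
    have \<alpha>: "\<alpha> \<in> T" "\<alpha> \<noteq> \<tau>" using sub that by auto
    then show "0 < tree_dist T \<Psi> \<alpha> \<tau>" using assms(2) by simp
    fix \<beta> assume "\<beta> \<in> mball \<alpha> (tree_dist T \<Psi> \<alpha> \<tau>)"
    then have \<beta>: "\<beta> \<in> T" "tree_dist T \<Psi> \<alpha> \<beta> < tree_dist T \<Psi> \<alpha> \<tau>" by auto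
    then have "\<tau> \<notin> segment T \<alpha> \<beta>"
      using tree_dist_additive_on_segment[OF \<alpha>(1) \<beta>(1) assms(2)] nonneg[of \<tau> \<beta>] by force
    with \<beta> show "\<beta> \<in> B"
      using mem_tangent_vector_iff[OF assms(2,3) that] by auto
  qed
  with sub show ?thesis unfolding openin_mtopology by blast
qed

end

theorem theorem4p10:
  fixes T :: "'a::order set"
  assumes "rooted_nonmetric_tree T"
    and "\<exists>\<sigma>\<in>T. uncountable (tangent_space T \<sigma>)"
  shows "\<not> first_countable (weak_tree_topology T) \<and>
    (\<forall>\<Psi>. increasing_parametrization T \<Psi> \<and> \<Psi> ` T \<subseteq> {1..\<infinity>} \<longrightarrow>
      {U. openin (weak_tree_topology T) U}
        \<subset> {U. openin (Metric_space.mtopology T (tree_dist T \<Psi>)) U})"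
proof (intro conjI allI impI)
  interpret rooted_nonmetric_tree T by (rule assms(1))
  show not_fc: "\<not> first_countable (weak_tree_topology T)"
    using assms(2) weak_tree_topology_not_first_countable by blast
  fix \<Psi> assume "increasing_parametrization T \<Psi> \<and> \<Psi> ` T \<subseteq> {1..\<infinity>}"
  then have metric: "Metric_space T (tree_dist T \<Psi>)"
    using Metric_space_tree_dist by blast
  let ?M = "Metric_space.mtopology T (tree_dist T \<Psi>)"
  have "openin ?M T"
    using Metric_space.topspace_mtopology[OF metric] openin_topspace[of ?M] by simp
  then have "{U. openin (weak_tree_topology T) U} \<subseteq> {U. openin ?M U}"
    using weak_tree_topology_minimal openin_metric_tangent_vector[OF metric] by blast
  moreover have "{U. openin (weak_tree_topology T) U} \<noteq> {U. openin ?M U}"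
  proof
    assume "{U. openin (weak_tree_topology T) U} = {U. openin ?M U}"
    then have "weak_tree_topology T = ?M" by (auto simp: topology_eq)
    with not_fc show False
      using Metric_space.first_countable_mtopology[OF metric] by simp
  qed
  ultimately show "{U. openin (weak_tree_topology T) U} \<subset> {U. openin ?M U}" by blast
qed

end
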